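(* Let $X$ be a complex Banach space, let $A:X\to X$ be an everywhere defined bounded linear operator, and let $\mathbb{P}(A):=\{p(A)\mid p\text{ a polynomial}\}\subset\mathscr{B}(X)$. Let $\zeta_0>\mathrm{spr}\,A$. Then $\mathcal{R}(\zeta_0,A)\in\overline{\mathbb{P}(A)}^{\|\cdot\|_{\mathrm{op}}}$. Moreover, $\mathcal{R}(\zeta,A)\in\overline{\mathbb{P}(A)}^{\|\cdot\|_{\mathrm{op}}}$ for all $\zeta\in\rho(A,\zeta_0)$, where $\rho(A,\zeta_0)$ is the connected component of the resolvent set $\rho(A)$ containing $\zeta_0$.
   Context: $\mathscr{B}(X)$ is the Banach space of bounded everywhere defined linear operators on $X$ with operator norm $\|\cdot\|_{\mathrm{op}}$; polynomials have complex coefficients; the overline denotes closure in operator norm. $\mathrm{spr}\,A$ is the spectral radius of $A$, $\rho(A)$ its resolvent set, and $\mathcal{R}(\zeta,A)=(A-\zeta\mathbb{1})^{-1}$ is the resolvent operator for $\zeta\in\rho(A)$. The condition $\zeta_0>\mathrm{spr}\,A$ means that $\zeta_0$ is a real number exceeding the spectral radius. *)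

theory Defs
  imports "HOL-Analysis.Analysis" "HOL-Computational_Algebra.Polynomial"
begin

text \<open>The distribution only provides real normed vector spaces.  A complex normed space is
  modelled as a real one with a compatible complex scalar multiplication, so that the topology,
  completeness and the type \<open>blinfun\<close> of bounded (real-)linear operators are inherited.\<close>

class complex_normed_vector = real_normed_vector +
  fixes scaleC :: "complex \<Rightarrow> 'a \<Rightarrow> 'a"  (infixr "*\<^sub>C" 75)
  assumes scaleC_add_right: "c *\<^sub>C (x + y) = c *\<^sub>C x + c *\<^sub>C y"
    and scaleC_add_left: "(c + d) *\<^sub>C x = c *\<^sub>C x + d *\<^sub>C x"
    and scaleC_scaleC: "c *\<^sub>C (d *\<^sub>C x) = (c * d) *\<^sub>C x"
    and scaleC_one: "1 *\<^sub>C x = x"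
    and scaleR_scaleC: "r *\<^sub>R x = complex_of_real r *\<^sub>C x"
    and norm_scaleC: "norm (c *\<^sub>C x) = cmod c * norm x"

class complex_banach = complex_normed_vector + complete_space

subclass (in complex_banach) banach ..

lemma bounded_linear_scaleC: "bounded_linear (\<lambda>x::'a::complex_normed_vector. c *\<^sub>C x)"
proof (rule bounded_linear_intro[where K = "cmod c"])
  fix r :: real and x :: 'a
  show "c *\<^sub>C (r *\<^sub>R x) = r *\<^sub>R (c *\<^sub>C x)"
    by (simp add: scaleR_scaleC scaleC_scaleC mult.commute)
qed (simp_all add: scaleC_add_right norm_scaleC mult.commute)

instantiation blinfun :: (real_normed_vector, complex_normed_vector) complex_normed_vector
begin

lift_definition scaleC_blinfun :: "complex \<Rightarrow> 'a \<Rightarrow>\<^sub>L 'b \<Rightarrow> 'a \<Rightarrow>\<^sub>L 'b"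
  is "\<lambda>c F x. c *\<^sub>C F x"
  by (rule bounded_linear_compose[OF bounded_linear_scaleC])

instance
proof
  fix c d :: complex and r :: real and F G :: "'a \<Rightarrow>\<^sub>L 'b"
  show "c *\<^sub>C (F + G) = c *\<^sub>C F + c *\<^sub>C G" by transfer (simp add: scaleC_add_right)
  show "(c + d) *\<^sub>C F = c *\<^sub>C F + d *\<^sub>C F" by transfer (simp add: scaleC_add_left)
  show "c *\<^sub>C (d *\<^sub>C F) = (c * d) *\<^sub>C F" by transfer (simp add: scaleC_scaleC)
  show "1 *\<^sub>C F = F" by transfer (simp add: scaleC_one)
  show "r *\<^sub>R F = complex_of_real r *\<^sub>C F" by transfer (simp add: scaleR_scaleC)
  have le: "norm (c *\<^sub>C G) \<le> cmod c * norm G" for c and G :: "'a \<Rightarrow>\<^sub>L 'b"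
  proof (rule norm_blinfun_bound)
    fix x
    have "norm (blinfun_apply (c *\<^sub>C G) x) = cmod c * norm (blinfun_apply G x)"
      by (simp add: scaleC_blinfun.rep_eq norm_scaleC)
    then show "norm (blinfun_apply (c *\<^sub>C G) x) \<le> cmod c * norm G * norm x"
      by (simp add: mult.assoc mult_left_mono norm_blinfun)
  qed simp
  show "norm (c *\<^sub>C F) = cmod c * norm F"
  proof (cases "c = 0")
    case True
    then show ?thesis using le[of c F] by simp
  next
    case False
    have "norm F = norm (inverse c *\<^sub>C (c *\<^sub>C F))"
      using False by transfer (simp add: scaleC_scaleC scaleC_one)
    also have "\<dots> \<le> norm (c *\<^sub>C F) / cmod c"
      using le[of "inverse c" "c *\<^sub>C F"] by (simp add: norm_inverse divide_inverse mult.commute)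
    finally have "cmod c * norm F \<le> norm (c *\<^sub>C F)"
      using False by (simp add: field_simps)
    with le[of c F] show ?thesis by simp
  qed
qed

end

text \<open>\<open>\<B>(X)\<close>: the complex-linear elements of \<open>'a \<Rightarrow>\<^sub>L 'a\<close>.  The norm of \<open>blinfun\<close> is the operator
  norm, and \<open>\<B>(X)\<close> is closed in \<open>'a \<Rightarrow>\<^sub>L 'a\<close>, so the closure of a subset of \<open>\<B>(X)\<close>
  is the same in either space.\<close>

definition bounded_operators :: "('a::complex_normed_vector \<Rightarrow>\<^sub>L 'a) set" where
  "bounded_operators =
    {F. \<forall>c x. blinfun_apply F (c *\<^sub>C x) = c *\<^sub>C blinfun_apply F x}"

lemma closed_bounded_operators:
  "closed (bounded_operators :: ('a::complex_normed_vector \<Rightarrow>\<^sub>L 'a) set)"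
proof -
  have eq: "(bounded_operators :: ('a \<Rightarrow>\<^sub>L 'a) set) =
      (\<Inter>c. \<Inter>x. {F. blinfun_apply F (c *\<^sub>C x) = c *\<^sub>C blinfun_apply F x})"
    by (auto simp: bounded_operators_def)
  have cl: "closed {F :: 'a \<Rightarrow>\<^sub>L 'a. blinfun_apply F (c *\<^sub>C x) = c *\<^sub>C blinfun_apply F x}"
    for c and x :: 'a
    by (intro closed_Collect_eq continuous_intros
        bounded_linear.continuous_on[OF bounded_linear_scaleC])
  show ?thesis unfolding eq by (intro closed_INT ballI cl)
qed

fun op_power :: "('a::real_normed_vector \<Rightarrow>\<^sub>L 'a) \<Rightarrow> nat \<Rightarrow> 'a \<Rightarrow>\<^sub>L 'a" where
  "op_power A 0 = id_blinfun"
| "op_power A (Suc n) = A o\<^sub>L op_power A n"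

definition op_poly :: "complex poly \<Rightarrow> ('a::complex_normed_vector \<Rightarrow>\<^sub>L 'a) \<Rightarrow> 'a \<Rightarrow>\<^sub>L 'a" where
  "op_poly p A = (\<Sum>i\<le>degree p. coeff p i *\<^sub>C op_power A i)"

definition op_polys :: "('a::complex_normed_vector \<Rightarrow>\<^sub>L 'a) \<Rightarrow> ('a \<Rightarrow>\<^sub>L 'a) set" where
  "op_polys A = {op_poly p A | p. True}"

definition is_inverse_op ::
  "('a::complex_normed_vector \<Rightarrow>\<^sub>L 'a) \<Rightarrow> ('a \<Rightarrow>\<^sub>L 'a) \<Rightarrow> bool" where
  "is_inverse_op T B \<longleftrightarrow>
    B \<in> bounded_operators \<and> T o\<^sub>L B = id_blinfun \<and> B o\<^sub>L T = id_blinfun"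

lemma is_inverse_op_unique:
  assumes "is_inverse_op T B" "is_inverse_op T C"
  shows "B = C"
proof -
  have "B = B o\<^sub>L (T o\<^sub>L C)" using assms by (auto simp: is_inverse_op_def intro: blinfun_eqI)
  also have "\<dots> = (B o\<^sub>L T) o\<^sub>L C" by (auto intro: blinfun_eqI)
  also have "\<dots> = C" using assms by (auto simp: is_inverse_op_def intro: blinfun_eqI)
  finally show ?thesis .
qed

definition resolvent_set :: "('a::complex_normed_vector \<Rightarrow>\<^sub>L 'a) \<Rightarrow> complex set" where
  "resolvent_set A = {\<zeta>. \<exists>B. is_inverse_op (A - \<zeta> *\<^sub>C id_blinfun) B}"

definition spectrum :: "('a::complex_normed_vector \<Rightarrow>\<^sub>L 'a) \<Rightarrow> complex set" where
  "spectrum A = - resolvent_set A"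

text \<open>The value is meaningful only for \<open>\<zeta> \<in> resolvent_set A\<close>, where the inverse is unique.\<close>

definition resolvent :: "complex \<Rightarrow> ('a::complex_normed_vector \<Rightarrow>\<^sub>L 'a) \<Rightarrow> 'a \<Rightarrow>\<^sub>L 'a" where
  "resolvent \<zeta> A = (THE B. is_inverse_op (A - \<zeta> *\<^sub>C id_blinfun) B)"

lemma is_inverse_op_resolvent:
  "\<zeta> \<in> resolvent_set A \<Longrightarrow> is_inverse_op (A - \<zeta> *\<^sub>C id_blinfun) (resolvent \<zeta> A)"
  unfolding resolvent_set_def resolvent_def
  by (auto intro: theI2 is_inverse_op_unique)

text \<open>Extended-real valued, so that the supremum is the genuine one in all cases; for
  \<open>A \<in> bounded_operators\<close> it is \<open>-\<infinity>\<close> exactly if \<open>X = {0}\<close>, where the spectrum is empty.\<close>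

definition spectral_radius :: "('a::complex_normed_vector \<Rightarrow>\<^sub>L 'a) \<Rightarrow> ereal" where
  "spectral_radius A = (SUP \<zeta>\<in>spectrum A. ereal (cmod \<zeta>))"

lemma spectral_radius_less_imp_resolvent_set:
  assumes "spectral_radius A < ereal r"
  shows "complex_of_real r \<in> resolvent_set A"
proof (rule ccontr)
  assume "complex_of_real r \<notin> resolvent_set A"
  then have "ereal (cmod (complex_of_real r)) \<le> spectral_radius A"
    unfolding spectral_radius_def spectrum_def by (intro SUP_upper) simp
  also have "\<dots> < ereal r" by fact
  finally show False by simp
qed

end

theory Submission
  imports Defs
begin

text \<open>
  Let \<open>P\<close> be the norm closure of the polynomials in \<open>A\<close>.  It is a closed commutative algebra of
  complex-linear operators.  The engine is a Neumann perturbation argument inside \<open>P\<close>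
  (\<open>inverse_perturbation_in_algebra\<close>): if \<open>T\<close> and \<open>R = T\<inverse>\<close> lie in \<open>P\<close> and \<open>C \<in> P\<close> satisfies
  \<open>\<parallel>C\<parallel> \<parallel>R\<parallel> < 1\<close>, then \<open>T - C\<close> is invertible with inverse in \<open>P\<close>.

  Taking \<open>T = -\<zeta>\<one>\<close> and \<open>C = -A\<close> gives \<open>\<R>(\<zeta>,A) \<in> P\<close> for \<open>\<bar>\<zeta>\<bar> > \<parallel>A\<parallel>\<close>.  Taking \<open>T = A - \<zeta>\<one>\<close>
  and \<open>C\<close> a small multiple of the identity shows that \<open>\<R>(\<zeta>,A) \<in> P\<close> persists under small changes
  of \<open>\<zeta>\<close>, by a step size governed by \<open>\<parallel>\<R>(\<zeta>,A)\<parallel>\<close>; since this norm is locally bounded, the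
  failure of the property persists under small changes too
  (\<open>resolvent_mem_closure_locally_constant\<close>).  So membership of the resolvent in \<open>P\<close> is locally
  constant on the resolvent set, hence constant on each of its connected components.

  Every real \<open>t \<ge> \<zeta>\<^sub>0\<close> exceeds the spectral radius, so the component of \<open>\<zeta>\<^sub>0\<close> contains the ray
  \<open>[\<zeta>\<^sub>0, \<infinity>)\<close>, and thereby a point where the resolvent is known to lie in \<open>P\<close>.  This settles both
  claims at once.  Arguing along the ray rather than on the annulus \<open>\<bar>\<zeta>\<bar> > spr A\<close> covers
  the zero space too, where the spectral radius is \<open>-\<infinity>\<close> and \<open>\<zeta>\<^sub>0\<close> may be negative.
\<close>

section \<open>Complex scalars and composition\<close>

lemma scaleC_zero_left [simp]: "0 *\<^sub>C (x::'a::complex_normed_vector) = 0"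
  using norm_scaleC[of 0 x] by simp

lemma scaleC_zero_right [simp]: "c *\<^sub>C (0::'a::complex_normed_vector) = 0"
  using norm_scaleC[of c "0::'a"] by simp

lemma scaleC_minus_left: "(- c) *\<^sub>C (x::'a::complex_normed_vector) = - (c *\<^sub>C x)"
  using scaleC_add_left[of c "- c" x] by (simp add: eq_neg_iff_add_eq_0 add.commute)

lemma scaleC_diff_left: "(c - d) *\<^sub>C (x::'a::complex_normed_vector) = c *\<^sub>C x - d *\<^sub>C x"
  using scaleC_add_left[of c "- d" x] by (simp add: scaleC_minus_left)

lemma scaleC_sum_right:
  "c *\<^sub>C (\<Sum>i\<in>I. f i :: 'a::complex_normed_vector) = (\<Sum>i\<in>I. c *\<^sub>C f i)"
  by (rule linear_sum[OF bounded_linear.linear[OF bounded_linear_scaleC]])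

lemma bounded_operators_scaleC:
  "F \<in> bounded_operators \<Longrightarrow> c *\<^sub>C F \<in> bounded_operators"
  by (simp add: bounded_operators_def scaleC_blinfun.rep_eq scaleC_scaleC mult.commute)

lemma bounded_operators_add:
  "F \<in> bounded_operators \<Longrightarrow> G \<in> bounded_operators \<Longrightarrow> F + G \<in> bounded_operators"
  by (simp add: bounded_operators_def blinfun.add_left scaleC_add_right)

lemma bounded_operators_compose:
  "F \<in> bounded_operators \<Longrightarrow> G \<in> bounded_operators \<Longrightarrow> F o\<^sub>L G \<in> bounded_operators"
  by (simp add: bounded_operators_def)

lemma bounded_operators_id: "id_blinfun \<in> bounded_operators"
  by (simp add: bounded_operators_def)

lemma bounded_operators_zero: "0 \<in> bounded_operators"
  by (simp add: bounded_operators_def)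

lemma compose_scaleC_left: "(c *\<^sub>C F) o\<^sub>L G = c *\<^sub>C (F o\<^sub>L G)"
  by (rule blinfun_eqI) (simp add: scaleC_blinfun.rep_eq)

lemma compose_scaleC_right:
  "F \<in> bounded_operators \<Longrightarrow> F o\<^sub>L (c *\<^sub>C G) = c *\<^sub>C (F o\<^sub>L G)"
  by (rule blinfun_eqI) (simp add: scaleC_blinfun.rep_eq bounded_operators_def)

lemmas compose_simps =
  bounded_bilinear.add_left[OF bounded_bilinear_blinfun_compose]
  bounded_bilinear.add_right[OF bounded_bilinear_blinfun_compose]
  bounded_bilinear.diff_left[OF bounded_bilinear_blinfun_compose]
  bounded_bilinear.diff_right[OF bounded_bilinear_blinfun_compose]
  bounded_bilinear.minus_left[OF bounded_bilinear_blinfun_compose]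
  bounded_bilinear.zero_left[OF bounded_bilinear_blinfun_compose]
  bounded_bilinear.zero_right[OF bounded_bilinear_blinfun_compose]

lemma compose_assoc: "(F o\<^sub>L G) o\<^sub>L H = F o\<^sub>L (G o\<^sub>L H)"
  by (rule blinfun_eqI) simp

lemma compose_id [simp]: "F o\<^sub>L id_blinfun = F" "id_blinfun o\<^sub>L F = F"
  by (auto intro: blinfun_eqI)


section \<open>The polynomial functional calculus\<close>

text \<open>Padding with zero coefficients puts polynomials of different degrees under a common range of
  summation.\<close>

lemma op_poly_eq_sum:
  assumes "degree p \<le> n"
  shows "op_poly p A = (\<Sum>i\<le>n. coeff p i *\<^sub>C op_power A i)"
  unfolding op_poly_def
  by (rule sum.mono_neutral_left) (use assms in \<open>auto simp: coeff_eq_0\<close>)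

lemma op_poly_0 [simp]: "op_poly 0 A = 0"
  by (simp add: op_poly_def)

lemma op_poly_add: "op_poly (p + q) A = op_poly p A + op_poly q A"
proof -
  define n where "n = max (degree p) (degree q)"
  have "degree p \<le> n" "degree q \<le> n" "degree (p + q) \<le> n"
    by (auto simp: n_def degree_add_le_max)
  then show ?thesis
    by (simp add: op_poly_eq_sum[where n = n] scaleC_add_left sum.distrib)
qed

lemma op_poly_smult: "op_poly (smult c p) A = c *\<^sub>C op_poly p A"
  by (simp add: op_poly_eq_sum[OF degree_smult_le] op_poly_def scaleC_sum_right scaleC_scaleC)

lemma op_poly_pCons:
  assumes "A \<in> bounded_operators"
  shows "op_poly (pCons c p) A = c *\<^sub>C id_blinfun + (A o\<^sub>L op_poly p A)"
proof -
  have "op_poly (pCons c p) A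
      = (\<Sum>i\<le>Suc (degree p). coeff (pCons c p) i *\<^sub>C op_power A i)"
    by (rule op_poly_eq_sum) (rule degree_pCons_le)
  also have "\<dots> = c *\<^sub>C id_blinfun + (\<Sum>i\<le>degree p. A o\<^sub>L (coeff p i *\<^sub>C op_power A i))"
    by (subst sum.atMost_Suc_shift) (simp add: compose_scaleC_right[OF assms])
  also have "\<dots> = c *\<^sub>C id_blinfun + (A o\<^sub>L op_poly p A)"
    by (simp add: op_poly_def bounded_bilinear.sum_right[OF bounded_bilinear_blinfun_compose])
  finally show ?thesis .
qed

lemma op_poly_mult:
  assumes "A \<in> bounded_operators"
  shows "op_poly (p * q) A = op_poly p A o\<^sub>L op_poly q A"
proof (induction p)
  case 0
  show ?case by (simp add: compose_simps)
next
  case (pCons c p)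
  then show ?case
    by (simp add: op_poly_add op_poly_smult op_poly_pCons[OF assms] compose_simps
        compose_scaleC_left compose_assoc)
qed

lemma op_poly_bounded_operators:
  assumes "A \<in> bounded_operators"
  shows "op_poly p A \<in> bounded_operators"
proof (induction p)
  case 0
  show ?case by (simp add: bounded_operators_zero)
next
  case (pCons c p)
  then show ?case
    by (simp add: op_poly_pCons assms bounded_operators_add bounded_operators_scaleC
        bounded_operators_compose bounded_operators_id)
qed


section \<open>The closed algebra generated by an operator\<close>

lemma op_poly_in_closure: "op_poly p A \<in> closure (op_polys A)"
  by (rule subsetD[OF closure_subset]) (auto simp: op_polys_def)

lemma scaleC_id_in_closure:
  assumes "A \<in> bounded_operators"
  shows "c *\<^sub>C id_blinfun \<in> closure (op_polys A)"
proof -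
  have "op_poly [:c:] A = c *\<^sub>C id_blinfun"
    by (simp add: op_poly_pCons[OF assms] compose_simps)
  then show ?thesis
    using op_poly_in_closure by metis
qed

lemma self_in_closure:
  assumes "A \<in> bounded_operators"
  shows "A \<in> closure (op_polys A)"
proof -
  have "op_poly [:0, 1:] A = A"
    by (simp add: op_poly_pCons[OF assms] compose_simps scaleC_one)
  then show ?thesis
    using op_poly_in_closure by metis
qed

lemma closure_op_polys_add:
  assumes "F \<in> closure (op_polys A)" "G \<in> closure (op_polys A)"
  shows "F + G \<in> closure (op_polys A)"
proof -
  obtain f where f: "\<forall>n. f n \<in> op_polys A" "f \<longlonglongrightarrow> F"
    using iffD1[OF closure_sequential assms(1)] by (elim exE conjE)
  obtain g where g: "\<forall>n. g n \<in> op_polys A" "g \<longlonglongrightarrow> G"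
    using iffD1[OF closure_sequential assms(2)] by (elim exE conjE)
  have "f n + g n \<in> op_polys A" for n
    using f(1)[rule_format, of n] g(1)[rule_format, of n]
    by (auto simp: op_polys_def op_poly_add[symmetric])
  then show ?thesis
    unfolding closure_sequential
    by (intro exI[of _ "\<lambda>n. f n + g n"] conjI allI tendsto_add f(2) g(2))
qed

lemma closure_op_polys_compose:
  assumes "A \<in> bounded_operators" "F \<in> closure (op_polys A)" "G \<in> closure (op_polys A)"
  shows "F o\<^sub>L G \<in> closure (op_polys A)" and "F o\<^sub>L G = G o\<^sub>L F"
proof -
  obtain f where f: "\<forall>n. f n \<in> op_polys A" "f \<longlonglongrightarrow> F"
    using iffD1[OF closure_sequential assms(2)] by (elim exE conjE)
  obtain g where g: "\<forall>n. g n \<in> op_polys A" "g \<longlonglongrightarrow> G"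
    using iffD1[OF closure_sequential assms(3)] by (elim exE conjE)
  have FG: "(\<lambda>n. f n o\<^sub>L g n) \<longlonglongrightarrow> (F o\<^sub>L G)" and GF: "(\<lambda>n. g n o\<^sub>L f n) \<longlonglongrightarrow> (G o\<^sub>L F)"
    by (intro bounded_bilinear.tendsto[OF bounded_bilinear_blinfun_compose] f g)+
  have fg: "f n o\<^sub>L g n \<in> op_polys A" "f n o\<^sub>L g n = g n o\<^sub>L f n" for n
  proof -
    obtain p q where "f n = op_poly p A" "g n = op_poly q A"
      using f(1)[rule_format, of n] g(1)[rule_format, of n] by (auto simp: op_polys_def)
    then show "f n o\<^sub>L g n \<in> op_polys A" "f n o\<^sub>L g n = g n o\<^sub>L f n"
      by (auto simp: op_polys_def op_poly_mult[OF assms(1), symmetric] mult.commute)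
  qed
  show "F o\<^sub>L G \<in> closure (op_polys A)"
    unfolding closure_sequential
    by (intro exI[of _ "\<lambda>n. f n o\<^sub>L g n"] conjI allI fg(1) FG)
  show "F o\<^sub>L G = G o\<^sub>L F"
    by (rule LIMSEQ_unique[OF FG]) (simp only: fg(2) GF)
qed

lemma closure_op_polys_bounded_operators:
  assumes "A \<in> bounded_operators"
  shows "closure (op_polys A) \<subseteq> bounded_operators"
  by (rule closure_minimal[OF _ closed_bounded_operators])
     (auto simp: op_polys_def op_poly_bounded_operators[OF assms])


section \<open>Perturbation of inverses\<close>

text \<open>
  The inverse of \<open>T - C\<close> is the solution \<open>B\<close> of \<open>B = R + R C B\<close>.  The right-hand side is a
  contraction in \<open>B\<close> that maps the closed set \<open>P\<close> into itself, so the solution exists and lies in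
  \<open>P\<close>; this replaces the summation of the Neumann series.  Applying \<open>T\<close> to the equation shows that
  \<open>B\<close> is a right inverse, and commutativity makes it a left inverse as well.
\<close>

lemma inverse_perturbation_in_algebra:
  fixes P :: "('a::complex_banach \<Rightarrow>\<^sub>L 'a) set"
  assumes P: "closed P" "P \<subseteq> bounded_operators"
    and add: "\<And>F G. F \<in> P \<Longrightarrow> G \<in> P \<Longrightarrow> F + G \<in> P"
    and comp: "\<And>F G. F \<in> P \<Longrightarrow> G \<in> P \<Longrightarrow> F o\<^sub>L G \<in> P"
    and comm: "\<And>F G. F \<in> P \<Longrightarrow> G \<in> P \<Longrightarrow> F o\<^sub>L G = G o\<^sub>L F"
    and mem: "T \<in> P" "C \<in> P" "R \<in> P"
    and inv: "is_inverse_op T R"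
    and small: "norm C * norm R < 1"
  shows "\<exists>B\<in>P. is_inverse_op (T - C) B"
proof -
  define \<Phi> where "\<Phi> B = R + (R o\<^sub>L (C o\<^sub>L B))" for B
  have "\<exists>!B\<in>P. \<Phi> B = B"
  proof (rule Banach_fix)
    show "complete P" using P by (simp add: complete_eq_closed)
    show "P \<noteq> {}" using mem by blast
    show "0 \<le> norm C * norm R" by simp
    show "norm C * norm R < 1" by fact
    show "\<Phi> ` P \<subseteq> P" by (auto simp: \<Phi>_def add comp mem)
    show "dist (\<Phi> F) (\<Phi> G) \<le> norm C * norm R * dist F G" for F G
    proof -
      have "dist (\<Phi> F) (\<Phi> G) = norm (R o\<^sub>L (C o\<^sub>L (F - G)))"
        by (simp add: \<Phi>_def dist_norm compose_simps)
      also have "\<dots> \<le> norm R * norm (C o\<^sub>L (F - G))"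
        by (rule norm_blinfun_compose)
      also have "\<dots> \<le> norm R * (norm C * norm (F - G))"
        by (intro mult_left_mono norm_blinfun_compose norm_ge_zero)
      finally show ?thesis by (simp add: dist_norm mult_ac)
    qed
  qed
  then obtain B where B: "B \<in> P" "R + (R o\<^sub>L (C o\<^sub>L B)) = B"
    unfolding \<Phi>_def by blast
  have TR: "T o\<^sub>L R = id_blinfun" using inv by (simp add: is_inverse_op_def)
  have "T o\<^sub>L B = T o\<^sub>L (R + (R o\<^sub>L (C o\<^sub>L B)))" using B(2) by simp
  also have "\<dots> = id_blinfun + (C o\<^sub>L B)"
    by (simp add: compose_simps TR compose_assoc[symmetric])
  finally have right: "(T - C) o\<^sub>L B = id_blinfun"
    by (simp add: compose_simps)
  moreover have "B o\<^sub>L (T - C) = (T - C) o\<^sub>L B"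
    by (simp add: compose_simps comm[OF mem(1) B(1)] comm[OF mem(2) B(1)])
  ultimately show ?thesis
    using B(1) P(2) by (auto simp: is_inverse_op_def)
qed

lemma resolvent_eqI: "is_inverse_op (A - \<zeta> *\<^sub>C id_blinfun) B \<Longrightarrow> resolvent \<zeta> A = B"
  unfolding resolvent_def by (blast intro: is_inverse_op_unique)

lemma inverse_perturbation_in_closure_op_polys:
  fixes A :: "'a::complex_banach \<Rightarrow>\<^sub>L 'a"
  assumes A: "A \<in> bounded_operators"
    and "T \<in> closure (op_polys A)" "C \<in> closure (op_polys A)" "R \<in> closure (op_polys A)"
    and "is_inverse_op T R" "norm C * norm R < 1"
    and eq: "T - C = A - \<zeta> *\<^sub>C id_blinfun"
  shows "resolvent \<zeta> A \<in> closure (op_polys A)"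
  using inverse_perturbation_in_algebra[OF closed_closure closure_op_polys_bounded_operators[OF A]
      closure_op_polys_add closure_op_polys_compose(1)[OF A] closure_op_polys_compose(2)[OF A]
      assms(2-6)]
  unfolding eq using resolvent_eqI by metis


section \<open>Resolvents as limits of polynomials\<close>

text \<open>For \<open>\<bar>\<zeta>\<bar> > \<parallel>A\<parallel>\<close> the operator \<open>A - \<zeta>\<one>\<close> is a small perturbation of \<open>-\<zeta>\<one>\<close>, whose inverse is
  itself a constant polynomial in \<open>A\<close>.\<close>

lemma resolvent_mem_closure_large:
  fixes A :: "'a::complex_banach \<Rightarrow>\<^sub>L 'a"
  assumes A: "A \<in> bounded_operators" and large: "norm A < cmod \<zeta>"
  shows "resolvent \<zeta> A \<in> closure (op_polys A)"
proof -
  \<comment> \<open>\<open>-A\<close> is written as a product so that its membership follows from closure under composition.\<close>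
  let ?T = "(- \<zeta>) *\<^sub>C (id_blinfun :: 'a \<Rightarrow>\<^sub>L 'a)"
    and ?R = "(- inverse \<zeta>) *\<^sub>C (id_blinfun :: 'a \<Rightarrow>\<^sub>L 'a)"
    and ?C = "(- 1) *\<^sub>C id_blinfun o\<^sub>L A"
  have "\<zeta> \<noteq> 0" using large by auto
  have C: "?C = - A"
    by (simp add: compose_simps scaleC_minus_left scaleC_one)
  show ?thesis
  proof (rule inverse_perturbation_in_closure_op_polys[OF A, where T = ?T and C = ?C and R = ?R])
    show "?T \<in> closure (op_polys A)" "?R \<in> closure (op_polys A)"
      by (rule scaleC_id_in_closure[OF A])+
    show "?C \<in> closure (op_polys A)"
      by (intro closure_op_polys_compose(1) scaleC_id_in_closure self_in_closure A)
    show "is_inverse_op ?T ?R"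
      using \<open>\<zeta> \<noteq> 0\<close> unfolding is_inverse_op_def
      by (simp add: bounded_operators_scaleC bounded_operators_id compose_scaleC_left scaleC_scaleC
          scaleC_one)
    have "norm ?C * norm ?R \<le> norm A * inverse (cmod \<zeta>)"
      unfolding C norm_scaleC norm_minus_cancel norm_inverse
      by (intro mult_left_mono mult_left_le norm_blinfun_id_le) auto
    also have "\<dots> < 1"
      using large \<open>\<zeta> \<noteq> 0\<close> by (simp add: field_simps)
    finally show "norm ?C * norm ?R < 1" .
    show "?T - ?C = A - \<zeta> *\<^sub>C id_blinfun"
      unfolding C by (simp add: scaleC_minus_left)
  qed
qed

lemma resolvent_mem_closure_step:
  fixes A :: "'a::complex_banach \<Rightarrow>\<^sub>L 'a"
  assumes A: "A \<in> bounded_operators" and \<zeta>: "\<zeta> \<in> resolvent_set A"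
    and mem: "resolvent \<zeta> A \<in> closure (op_polys A)"
    and small: "cmod (\<eta> - \<zeta>) * norm (resolvent \<zeta> A) < 1"
  shows "resolvent \<eta> A \<in> closure (op_polys A)"
proof (rule inverse_perturbation_in_closure_op_polys[OF A _ _ mem is_inverse_op_resolvent[OF \<zeta>]])
  let ?C = "(\<eta> - \<zeta>) *\<^sub>C (id_blinfun :: 'a \<Rightarrow>\<^sub>L 'a)"
  have "A - \<zeta> *\<^sub>C id_blinfun = A + (- \<zeta>) *\<^sub>C id_blinfun"
    by (simp add: scaleC_minus_left)
  then show "A - \<zeta> *\<^sub>C id_blinfun \<in> closure (op_polys A)"
    by (simp only: closure_op_polys_add self_in_closure scaleC_id_in_closure A)
  show "?C \<in> closure (op_polys A)"
    by (rule scaleC_id_in_closure[OF A])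
  have "norm ?C \<le> cmod (\<eta> - \<zeta>)"
    unfolding norm_scaleC by (intro mult_left_le norm_blinfun_id_le) auto
  then have "norm ?C * norm (resolvent \<zeta> A) \<le> cmod (\<eta> - \<zeta>) * norm (resolvent \<zeta> A)"
    by (rule mult_right_mono) simp
  with small show "norm ?C * norm (resolvent \<zeta> A) < 1" by linarith
  show "A - \<zeta> *\<^sub>C id_blinfun - ?C = A - \<eta> *\<^sub>C id_blinfun"
    by (simp add: scaleC_diff_left)
qed

lemma resolvent_identity:
  assumes "\<zeta> \<in> resolvent_set A" "\<eta> \<in> resolvent_set A"
  shows "resolvent \<eta> A - resolvent \<zeta> A = (\<eta> - \<zeta>) *\<^sub>C (resolvent \<zeta> A o\<^sub>L resolvent \<eta> A)"
proof -
  let ?R = "resolvent \<zeta> A" and ?S = "resolvent \<eta> A"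
  have R: "?R \<in> bounded_operators" "?R o\<^sub>L (A - \<zeta> *\<^sub>C id_blinfun) = id_blinfun"
    and S: "(A - \<eta> *\<^sub>C id_blinfun) o\<^sub>L ?S = id_blinfun"
    using assms[THEN is_inverse_op_resolvent] by (auto simp: is_inverse_op_def)
  have "?S - ?R = ((?R o\<^sub>L (A - \<zeta> *\<^sub>C id_blinfun)) o\<^sub>L ?S) - (?R o\<^sub>L ((A - \<eta> *\<^sub>C id_blinfun) o\<^sub>L ?S))"
    by (simp only: R S compose_id)
  also have "\<dots> = ?R o\<^sub>L (((\<eta> - \<zeta>) *\<^sub>C id_blinfun) o\<^sub>L ?S)"
    by (simp add: compose_assoc compose_simps scaleC_diff_left compose_scaleC_left)
  also have "\<dots> = (\<eta> - \<zeta>) *\<^sub>C (?R o\<^sub>L ?S)"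
    by (simp add: compose_scaleC_left compose_scaleC_right[OF R(1)])
  finally show ?thesis .
qed

text \<open>
  By the resolvent identity, \<open>\<parallel>\<R>(\<eta>,A)\<parallel> \<le> 2 \<parallel>\<R>(\<zeta>,A)\<parallel>\<close> once \<open>2 \<bar>\<eta> - \<zeta>\<bar> \<parallel>\<R>(\<zeta>,A)\<parallel> < 1\<close>.  Then
  \<open>\<bar>\<zeta> - \<eta>\<bar> \<parallel>\<R>(\<eta>,A)\<parallel> < 1\<close> as well, so \<open>resolvent_mem_closure_step\<close> also leads from \<open>\<eta>\<close> back
  to \<open>\<zeta>\<close>.
\<close>

lemma resolvent_mem_closure_locally_constant:
  fixes A :: "'a::complex_banach \<Rightarrow>\<^sub>L 'a"
  assumes A: "A \<in> bounded_operators" and \<zeta>: "\<zeta> \<in> resolvent_set A" and \<eta>: "\<eta> \<in> resolvent_set A"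
    and small: "2 * cmod (\<eta> - \<zeta>) * norm (resolvent \<zeta> A) < 1"
  shows "resolvent \<zeta> A \<in> closure (op_polys A) \<longleftrightarrow> resolvent \<eta> A \<in> closure (op_polys A)"
proof
  have "cmod (\<eta> - \<zeta>) * norm (resolvent \<zeta> A) \<ge> 0" by simp
  then have "cmod (\<eta> - \<zeta>) * norm (resolvent \<zeta> A) < 1" using small by linarith
  then show "resolvent \<eta> A \<in> closure (op_polys A)" if "resolvent \<zeta> A \<in> closure (op_polys A)"
    by (rule resolvent_mem_closure_step[OF A \<zeta> that])
next
  let ?h = "cmod (\<eta> - \<zeta>)" and ?r = "norm (resolvent \<zeta> A)" and ?s = "norm (resolvent \<eta> A)"
  have "?s \<le> ?r + norm (resolvent \<eta> A - resolvent \<zeta> A)"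
    by (rule norm_triangle_sub)
  also have "\<dots> \<le> ?r + ?h * (?r * ?s)"
    unfolding resolvent_identity[OF \<zeta> \<eta>] norm_scaleC
    by (intro add_left_mono mult_left_mono norm_blinfun_compose) simp
  also have "?h * (?r * ?s) \<le> ?s / 2"
    using mult_right_mono[of "2 * ?h * ?r" 1 ?s] small by simp
  finally have "?s \<le> 2 * ?r" by simp
  then have "?h * ?s \<le> ?h * (2 * ?r)" by (rule mult_left_mono) simp
  also have "\<dots> < 1" using small by (simp add: mult_ac)
  finally have "cmod (\<zeta> - \<eta>) * ?s < 1" by (simp add: norm_minus_commute)
  then show "resolvent \<zeta> A \<in> closure (op_polys A)" if "resolvent \<eta> A \<in> closure (op_polys A)"
    by (rule resolvent_mem_closure_step[OF A \<eta> that])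
qed

lemma resolvent_mem_closure_connected:
  fixes A :: "'a::complex_banach \<Rightarrow>\<^sub>L 'a"
  assumes A: "A \<in> bounded_operators" and K: "connected K" "K \<subseteq> resolvent_set A"
    and "\<zeta> \<in> K" "\<eta> \<in> K"
  shows "resolvent \<zeta> A \<in> closure (op_polys A) \<longleftrightarrow> resolvent \<eta> A \<in> closure (op_polys A)"
proof (rule connected_local_const[OF K(1) \<open>\<zeta> \<in> K\<close> \<open>\<eta> \<in> K\<close>], rule ballI)
  fix a assume "a \<in> K"
  \<comment> \<open>The additional \<open>1\<close> keeps the denominator positive, since the resolvent vanishes on the zero space.\<close>
  define d where "d = 1 / (2 * norm (resolvent a A) + 1)"
  have den: "2 * norm (resolvent a A) + 1 > 0"
    by (rule add_nonneg_pos) auto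
  then have "d > 0" by (simp add: d_def)
  show "\<forall>\<^sub>F b in at a within K. (resolvent a A \<in> closure (op_polys A)) =
      (resolvent b A \<in> closure (op_polys A))"
    unfolding eventually_at
  proof (intro exI[of _ d] conjI ballI impI \<open>d > 0\<close>)
    fix b assume b: "b \<in> K" "b \<noteq> a \<and> dist b a < d"
    have "2 * cmod (b - a) * norm (resolvent a A)
        \<le> cmod (b - a) * (2 * norm (resolvent a A) + 1)"
      by (simp add: algebra_simps)
    also have "\<dots> < 1"
      using b den by (simp add: d_def dist_norm pos_less_divide_eq)
    finally show "(resolvent a A \<in> closure (op_polys A)) = (resolvent b A \<in> closure (op_polys A))"
      using \<open>a \<in> K\<close> b K(2) by (intro resolvent_mem_closure_locally_constant[OF A]) auto
  qed
qed

theorem theorem3p1: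
  fixes A :: "'a::complex_banach \<Rightarrow>\<^sub>L 'a" and \<zeta>\<^sub>0 :: real
  assumes "A \<in> bounded_operators"
    and "ereal \<zeta>\<^sub>0 > spectral_radius A"
  shows "resolvent (complex_of_real \<zeta>\<^sub>0) A \<in> closure (op_polys A) \<and>
    (\<forall>\<zeta>\<in>connected_component_set (resolvent_set A) (complex_of_real \<zeta>\<^sub>0).
      resolvent \<zeta> A \<in> closure (op_polys A))"
proof -
  let ?K = "connected_component_set (resolvent_set A) (complex_of_real \<zeta>\<^sub>0)"
  define t where "t = max \<zeta>\<^sub>0 (norm A + 1)"
  have ray: "complex_of_real ` {\<zeta>\<^sub>0..} \<subseteq> ?K"
  proof (rule connected_component_maximal)
    show "complex_of_real \<zeta>\<^sub>0 \<in> complex_of_real ` {\<zeta>\<^sub>0..}" by simp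
    show "connected (complex_of_real ` {\<zeta>\<^sub>0..})"
      by (intro connected_continuous_image continuous_intros convex_connected) auto
    show "complex_of_real ` {\<zeta>\<^sub>0..} \<subseteq> resolvent_set A"
    proof clarify
      fix s assume "s \<ge> \<zeta>\<^sub>0"
      then have "spectral_radius A < ereal s"
        using assms(2) by (meson ereal_less_eq(3) less_le_trans)
      then show "complex_of_real s \<in> resolvent_set A"
        by (rule spectral_radius_less_imp_resolvent_set)
    qed
  qed
  have mem: "complex_of_real t \<in> ?K" "complex_of_real \<zeta>\<^sub>0 \<in> ?K"
    by (intro subsetD[OF ray] imageI, simp add: t_def)+
  have "norm A < cmod (complex_of_real t)"
    by (simp add: t_def)
  then have "resolvent (complex_of_real t) A \<in> closure (op_polys A)"
    by (rule resolvent_mem_closure_large[OF assms(1)])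
  then have "resolvent \<zeta> A \<in> closure (op_polys A)" if "\<zeta> \<in> ?K" for \<zeta>
    using resolvent_mem_closure_connected[OF assms(1) connected_connected_component
        connected_component_subset that mem(1)] by simp
  with mem(2) show ?thesis by blast
qed

end
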